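(* The linear map $\boldsymbol\rho\colon\mathcal MSym\to\mathcal MSym\otimes\mathcal YSym$ defined for $b\in\mathcal M_\bullet$ by $$\boldsymbol\rho(F_b)=\sum_{b\to(b_0,b_1)}F_{b_0}\otimes F_{\phi(b_1)},$$ the sum being over all splittings of $b$ along one leaf, makes $\mathcal MSym$ a right $\mathcal YSym$-comodule.
   Context: Trees. $\mathcal Y_n$ is the set of rooted planar binary trees with $n$ internal nodes; $|$ is the tree with no nodes; $t_\ell\vee t_r$ is the tree whose root node has left subtree $t_\ell$ and right subtree $t_r$. A tree $t\in\mathcal Y_n$ has leaves numbered $0,\dots,n$ from left to right and nodes numbered $1,\dots,n$ from left to right (node $i$ corresponds to the gap between leaves $i-1$ and $i$). The node poset of $t$ has the internal edges as Hasse diagram and the root as maximum. Splitting. Splitting $t\in\mathcal Y_n$ along leaf $i$ means cutting along the path from leaf $i$ to the root, giving a pair $t\to(t_0,t_1)$ with $t_0\in\mathcal Y_i$ containing nodes $1,\dots,i$ and $t_1\in\mathcal Y_{n-i}$ containing nodes $i+1,\dots,n$. Recursively: $|\to(|,|)$; for $t=a\vee c$ with $a\in\mathcal Y_p$, if $i\le p$ and $a\to(a_0,a_1)$ along leaf $i$ then $t\to(a_0,a_1\vee c)$; if $i>p$ and $c\to(c_0,c_1)$ along leaf $i-p-1$ then $t\to(a\vee c_0,c_1)$. Bi-leveled trees. A bi-leveled tree with $n$ nodes is a pair $b=(t;\mathsf T)$ with $t\in\mathcal Y_n$ and $\mathsf T\subseteq\{1,\dots,n\}$ an upper order ideal of the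 node poset of $t$ containing the leftmost node (node $1$) as a minimal element of $\mathsf T$. $\mathcal M_n$ is the set of these; $\mathcal M_0=\{|\}$ (with empty ideal); $\mathcal M_\bullet=\bigsqcup_n\mathcal M_n$. A splitting $t\to(t_0,t_1)$ induces the splitting $b\to(b_0,b_1)$ with $b_i=(t_i;\mathsf T|_{t_i})$, where $\mathsf T|_{t_i}$ is the set of nodes of $t_i$ coming from $\mathsf T$; $b_0$ is always a bi-leveled tree, $b_1$ need not be. $\phi(b_1)=t_1$ denotes the underlying tree. Spaces. $\mathcal MSym$ is the graded $\mathbb Q$-vector space with basis $\{F_b\mid b\in\mathcal M_\bullet\}$. $\mathcal YSym$ is the Loday–Ronco Hopf algebra: the graded $\mathbb Q$-vector space with basis $\{F_t\mid t\in\mathcal Y_n,\,n\ge0\}$, with coproduct $\Delta F_t=\sum_{t\to(t_0,t_1)}F_{t_0}\otimes F_{t_1}$ (sum over the $n+1$ splittings along a leaf) and counit the projection to the degree-$0$ part spanned by $F_|=1$. *)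

theory Defs
  imports Complex_Main "HOL-Library.Poly_Mapping"
begin

section \<open>Free vector spaces and their tensor products\<close>

text \<open>
  The vector space over a field \<open>'k\<close> with basis (indexed by) \<open>'a\<close> is the type \<open>'a \<Rightarrow>\<^sub>0 'k\<close> of
  finitely supported functions.
\<close>

definition fscale :: "'k::field \<Rightarrow> ('a \<Rightarrow>\<^sub>0 'k) \<Rightarrow> ('a \<Rightarrow>\<^sub>0 'k)"  (infixr \<open>*\<^sub>F\<close> 75)
  where "c *\<^sub>F x = Poly_Mapping.map ((*) c) x"

abbreviation F :: "'a \<Rightarrow> ('a \<Rightarrow>\<^sub>0 'k::field)"
  where "F a \<equiv> Poly_Mapping.single a 1"

lemma lookup_fscale [simp]: "Poly_Mapping.lookup (c *\<^sub>F x) a = c * Poly_Mapping.lookup x a"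
  by (simp add: fscale_def Poly_Mapping.map.rep_eq when_def)

lemma vector_space_fscale: "vector_space (fscale :: 'k::field \<Rightarrow> ('a \<Rightarrow>\<^sub>0 'k) \<Rightarrow> _)"
  by unfold_locales (auto intro!: poly_mapping_eqI simp: lookup_add algebra_simps)

lemma vector_space_mult: "vector_space ((*) :: 'k::field \<Rightarrow> 'k \<Rightarrow> 'k)"
  by unfold_locales (auto simp: algebra_simps)

abbreviation flinear :: "(('a \<Rightarrow>\<^sub>0 'k::field) \<Rightarrow> ('b \<Rightarrow>\<^sub>0 'k)) \<Rightarrow> bool"
  where "flinear \<equiv> Vector_Spaces.linear fscale fscale"

abbreviation ffunctional :: "(('a \<Rightarrow>\<^sub>0 'k::field) \<Rightarrow> 'k) \<Rightarrow> bool"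
  where "ffunctional \<equiv> Vector_Spaces.linear fscale (*)"

definition lin_ext :: "('a \<Rightarrow> ('b \<Rightarrow>\<^sub>0 'k::field)) \<Rightarrow> ('a \<Rightarrow>\<^sub>0 'k) \<Rightarrow> ('b \<Rightarrow>\<^sub>0 'k)"
  where "lin_ext f x = (\<Sum>a\<in>Poly_Mapping.keys x. Poly_Mapping.lookup x a *\<^sub>F f a)"

lemma lin_ext_superset:
  assumes "finite A" "Poly_Mapping.keys x \<subseteq> A"
  shows "lin_ext f x = (\<Sum>a\<in>A. Poly_Mapping.lookup x a *\<^sub>F f a)"
  unfolding lin_ext_def
  by (rule sum.mono_neutral_left)
     (use assms in \<open>auto simp: in_keys_iff intro!: poly_mapping_eqI\<close>)

lemma flinear_lin_ext:
  fixes f :: "'a \<Rightarrow> ('b \<Rightarrow>\<^sub>0 'k::field)"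
  shows "flinear (lin_ext f)"
proof -
  interpret v: vector_space "fscale :: 'k \<Rightarrow> ('b \<Rightarrow>\<^sub>0 'k) \<Rightarrow> _"
    by (rule vector_space_fscale)
  have "lin_ext f (x + y) = lin_ext f x + lin_ext f y" for x y
  proof -
    have "Poly_Mapping.keys (x + y) \<subseteq> Poly_Mapping.keys x \<union> Poly_Mapping.keys y"
      by (rule keys_add)
    then show ?thesis
      by (simp add: lin_ext_superset[of "Poly_Mapping.keys x \<union> Poly_Mapping.keys y"] lookup_add
          v.scale_left_distrib sum.distrib)
  qed
  moreover have "lin_ext f (c *\<^sub>F x) = c *\<^sub>F lin_ext f x" for c x
  proof -
    have "Poly_Mapping.keys (c *\<^sub>F x) \<subseteq> Poly_Mapping.keys x" by (auto simp: in_keys_iff)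
    then show ?thesis
      by (simp add: lin_ext_superset[of "Poly_Mapping.keys x"] v.scale_sum_right)
  qed
  ultimately show ?thesis
    by (intro Vector_Spaces.linear_iff[THEN iffD2] conjI allI vector_space_fscale) auto
qed

lemma lin_ext_F [simp]: "lin_ext f (F a) = f a"
  by (auto simp: lin_ext_def intro!: poly_mapping_eqI)

lemma lin_ext_self: "lin_ext F x = x"
proof (rule poly_mapping_eqI)
  fix a
  have "Poly_Mapping.lookup (lin_ext F x) a =
    (\<Sum>b\<in>Poly_Mapping.keys x. if b = a then Poly_Mapping.lookup x b else 0)"
    unfolding lin_ext_def lookup_sum
    by (rule sum.cong) (auto simp: lookup_single when_def)
  also have "\<dots> = Poly_Mapping.lookup x a" by (auto simp: in_keys_iff)
  finally show "Poly_Mapping.lookup (lin_ext F x) a = Poly_Mapping.lookup x a" .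
qed

lemma flinear_eq_lin_ext:
  assumes "flinear g"
  shows "g = lin_ext (\<lambda>a. g (F a))"
proof
  fix x
  interpret g: Vector_Spaces.linear fscale fscale g by (rule assms)
  have "g x = g (\<Sum>a\<in>Poly_Mapping.keys x. Poly_Mapping.lookup x a *\<^sub>F F a)"
    using lin_ext_self[of x] by (simp add: lin_ext_def)
  then show "g x = lin_ext (\<lambda>a. g (F a)) x"
    by (simp add: g.sum g.scale lin_ext_def)
qed

text \<open>
  The tensor product of the spaces with bases \<open>'a\<close> and \<open>'b\<close> is realised as the space with basis
  \<open>'a \<times> 'b\<close>, where \<open>F a \<otimes> F b = F (a, b)\<close>; the lemma \<open>tensor_universal\<close> below is its universal
  property for bilinear maps.
\<close>

definition tensor :: "('a \<Rightarrow>\<^sub>0 'k::field) \<Rightarrow> ('b \<Rightarrow>\<^sub>0 'k) \<Rightarrow> ('a \<times> 'b \<Rightarrow>\<^sub>0 'k)"  (infixr \<open>\<otimes>\<close> 76)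
  where "x \<otimes> y = lin_ext (\<lambda>a. lin_ext (\<lambda>b. F (a, b)) y) x"

lemma lookup_tensor:
  "Poly_Mapping.lookup (x \<otimes> y) (a, b) =
  Poly_Mapping.lookup x a * Poly_Mapping.lookup y b"
proof -
  have 1: "Poly_Mapping.lookup (lin_ext (\<lambda>b. F (a', b)) y) (a, b) =
    (if a' = a then Poly_Mapping.lookup y b else 0)" for a'
  proof -
    have "Poly_Mapping.lookup (lin_ext (\<lambda>b. F (a', b)) y) (a, b)
      = (\<Sum>b'\<in>Poly_Mapping.keys y. if b' = b then (if a' = a then Poly_Mapping.lookup y b else 0) else 0)"
      unfolding lin_ext_def lookup_sum
      by (rule sum.cong) (auto simp: lookup_single when_def)
    then show ?thesis by (auto simp: in_keys_iff)
  qed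
  have "Poly_Mapping.lookup (x \<otimes> y) (a, b) = (\<Sum>a'\<in>Poly_Mapping.keys x.
      if a' = a then Poly_Mapping.lookup x a * Poly_Mapping.lookup y b else 0)"
    unfolding tensor_def lin_ext_def[of _ x] lookup_sum lookup_fscale 1
    by (rule sum.cong) auto
  then show ?thesis by (auto simp: in_keys_iff)
qed

lemma tensor_F [simp]: "F a \<otimes> F b = F (a, b)"
  by (simp add: tensor_def)

lemma flinear_tensor_left: "flinear (\<lambda>x. x \<otimes> y)"
  by (intro Vector_Spaces.linear_iff[THEN iffD2] conjI allI vector_space_fscale)
     (auto intro!: poly_mapping_eqI simp: lookup_tensor lookup_add algebra_simps)

lemma flinear_tensor_right: "flinear (\<lambda>y. x \<otimes> y)"
  by (intro Vector_Spaces.linear_iff[THEN iffD2] conjI allI vector_space_fscale)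
     (auto intro!: poly_mapping_eqI simp: lookup_tensor lookup_add algebra_simps)

lemma tensor_universal:
  fixes B :: "('a \<Rightarrow>\<^sub>0 'k::field) \<Rightarrow> ('b \<Rightarrow>\<^sub>0 'k) \<Rightarrow> ('c \<Rightarrow>\<^sub>0 'k)"
  assumes l: "\<And>y. flinear (\<lambda>x. B x y)" and r: "\<And>x. flinear (\<lambda>y. B x y)"
  shows "\<exists>!g. flinear g \<and> (\<forall>x y. g (x \<otimes> y) = B x y)"
proof (rule ex1I)
  let ?g = "lin_ext (\<lambda>(a, b). B (F a) (F b))"
  have "?g (x \<otimes> y) = B x y" for x y
  proof -
    have cmp: "flinear (\<lambda>x. h (k x))" if "flinear h" "flinear k"
      for h :: "('d \<Rightarrow>\<^sub>0 'k) \<Rightarrow> ('e \<Rightarrow>\<^sub>0 'k)" and k :: "('f \<Rightarrow>\<^sub>0 'k) \<Rightarrow> ('d \<Rightarrow>\<^sub>0 'k)"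
      using Vector_Spaces.linear_compose[OF that(2,1)] by (simp add: o_def)
    have 1: "?g (F a \<otimes> y) = B (F a) y" for a
    proof -
      have "(\<lambda>y. ?g (F a \<otimes> y)) = lin_ext (\<lambda>b. ?g (F a \<otimes> F b))"
        by (rule flinear_eq_lin_ext[OF cmp[OF flinear_lin_ext flinear_tensor_right]])
      also have "\<dots> = lin_ext (\<lambda>b. B (F a) (F b))" by simp
      also have "\<dots> = (\<lambda>y. B (F a) y)" by (rule flinear_eq_lin_ext[OF r, symmetric])
      finally show ?thesis by meson
    qed
    have "(\<lambda>x. ?g (x \<otimes> y)) = lin_ext (\<lambda>a. ?g (F a \<otimes> y))"
      by (rule flinear_eq_lin_ext[OF cmp[OF flinear_lin_ext flinear_tensor_left]])
    also have "\<dots> = lin_ext (\<lambda>a. B (F a) y)" by (simp add: 1)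
    also have "\<dots> = (\<lambda>x. B x y)" by (rule flinear_eq_lin_ext[OF l, symmetric])
    finally show ?thesis by meson
  qed
  then show "flinear ?g \<and> (\<forall>x y. ?g (x \<otimes> y) = B x y)"
    by (simp add: flinear_lin_ext)
next
  fix g assume g: "flinear g \<and> (\<forall>x y. g (x \<otimes> y) = B x y)"
  then have "g (F (a, b)) = B (F a) (F b)" for a b
    by (metis tensor_F)
  then have "(\<lambda>p. g (F p)) = (\<lambda>(a, b). B (F a) (F b))"
    by auto
  then show "g = lin_ext (\<lambda>(a, b). B (F a) (F b))"
    using flinear_eq_lin_ext[of g] g by simp
qed

text \<open>
  For linear \<open>f\<close> and \<open>g\<close>, \<open>tensor_map f g\<close> is the map \<open>f \<otimes> g\<close>. The maps \<open>tensor_assoc\<close>,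
  \<open>tensor_unit_left\<close> and \<open>tensor_unit_right\<close> make the canonical identifications
  \<open>(U \<otimes> V) \<otimes> W \<cong> U \<otimes> (V \<otimes> W)\<close>, \<open>k \<otimes> V \<cong> V\<close> and \<open>V \<otimes> k \<cong> V\<close> explicit: \<open>tensor_unit_left e\<close> is
  the composite of \<open>e \<otimes> id\<close> with the second one, \<open>tensor_unit_right e\<close> is the composite of
  \<open>id \<otimes> e\<close> with the third one.
\<close>

definition tensor_map ::
  "(('a \<Rightarrow>\<^sub>0 'k::field) \<Rightarrow> ('c \<Rightarrow>\<^sub>0 'k)) \<Rightarrow> (('b \<Rightarrow>\<^sub>0 'k) \<Rightarrow> ('d \<Rightarrow>\<^sub>0 'k)) \<Rightarrow>
   ('a \<times> 'b \<Rightarrow>\<^sub>0 'k) \<Rightarrow> ('c \<times> 'd \<Rightarrow>\<^sub>0 'k)"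
  where "tensor_map f g = lin_ext (\<lambda>(a, b). f (F a) \<otimes> g (F b))"

lemma tensor_map_tensor:
  assumes f: "flinear f" and g: "flinear g"
  shows "tensor_map f g (x \<otimes> y) = f x \<otimes> g y"
proof -
  note comp = Vector_Spaces.linear_compose[unfolded o_def]
  have "flinear (\<lambda>x. f x \<otimes> g y)" "flinear (\<lambda>y. f x \<otimes> g y)" for x y
    by (rule comp[OF f flinear_tensor_left] comp[OF g flinear_tensor_right])+
  then obtain h where h: "flinear h" "\<And>x y. h (x \<otimes> y) = f x \<otimes> g y"
    using tensor_universal[of "\<lambda>x y. f x \<otimes> g y"] by blast
  have "h (F p) = (case p of (a, b) \<Rightarrow> f (F a) \<otimes> g (F b))" for p
    by (cases p) (simp add: h(2) flip: tensor_F)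
  then have "h = tensor_map f g"
    using flinear_eq_lin_ext[OF h(1)] by (simp add: tensor_map_def)
  with h(2) show ?thesis by simp
qed

definition tensor_assoc :: "(('a \<times> 'b) \<times> 'c \<Rightarrow>\<^sub>0 'k::field) \<Rightarrow> ('a \<times> ('b \<times> 'c) \<Rightarrow>\<^sub>0 'k)"
  where "tensor_assoc = lin_ext (\<lambda>((a, b), c). F a \<otimes> (F b \<otimes> F c))"

definition tensor_unit_left ::
  "(('a \<Rightarrow>\<^sub>0 'k::field) \<Rightarrow> 'k) \<Rightarrow> ('a \<times> 'b \<Rightarrow>\<^sub>0 'k) \<Rightarrow> ('b \<Rightarrow>\<^sub>0 'k)"
  where "tensor_unit_left e = lin_ext (\<lambda>(a, b). e (F a) *\<^sub>F F b)"

definition tensor_unit_right ::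
  "(('b \<Rightarrow>\<^sub>0 'k::field) \<Rightarrow> 'k) \<Rightarrow> ('a \<times> 'b \<Rightarrow>\<^sub>0 'k) \<Rightarrow> ('a \<Rightarrow>\<^sub>0 'k)"
  where "tensor_unit_right e = lin_ext (\<lambda>(a, b). e (F b) *\<^sub>F F a)"


section \<open>Coalgebras and right comodules\<close>

locale coalgebra =
  fixes \<Delta> :: "('c \<Rightarrow>\<^sub>0 'k::field) \<Rightarrow> ('c \<times> 'c \<Rightarrow>\<^sub>0 'k)"
    and \<epsilon> :: "('c \<Rightarrow>\<^sub>0 'k) \<Rightarrow> 'k"
  assumes linear_coproduct: "flinear \<Delta>"
    and linear_counit: "ffunctional \<epsilon>"
    and coassoc: "tensor_assoc (tensor_map \<Delta> id (\<Delta> x)) = tensor_map id \<Delta> (\<Delta> x)"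
    and counit_left: "tensor_unit_left \<epsilon> (\<Delta> x) = x"
    and counit_right: "tensor_unit_right \<epsilon> (\<Delta> x) = x"

locale right_comodule = coalgebra \<Delta> \<epsilon>
  for \<Delta> :: "('c \<Rightarrow>\<^sub>0 'k::field) \<Rightarrow> ('c \<times> 'c \<Rightarrow>\<^sub>0 'k)"
    and \<epsilon> :: "('c \<Rightarrow>\<^sub>0 'k) \<Rightarrow> 'k" +
  fixes \<rho> :: "('m \<Rightarrow>\<^sub>0 'k) \<Rightarrow> ('m \<times> 'c \<Rightarrow>\<^sub>0 'k)"
  assumes linear_coaction: "flinear \<rho>"
    and coaction_coassoc: "tensor_assoc (tensor_map \<rho> id (\<rho> x)) = tensor_map id \<Delta> (\<rho> x)"
    and coaction_counit: "tensor_unit_right \<epsilon> (\<rho> x) = x"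


section \<open>Planar binary trees and their splittings\<close>

text \<open>Only internal nodes count: \<open>size\<close> is the number of nodes, so \<open>\<Y>\<^sub>n = {t. size t = n}\<close>.\<close>

datatype ptree = Leaf | Node ptree ptree  (infix \<open>\<or>\<^sub>t\<close> 65)

text \<open>
  Nodes are numbered \<open>1, \<dots>, size t\<close> from left to right, so the root of \<open>l \<or>\<^sub>t r\<close> has number
  \<open>size l + 1\<close>, and the nodes of \<open>r\<close> are shifted by this number. The value on \<open>Leaf\<close> is a dummy.
\<close>

fun root_node :: "ptree \<Rightarrow> nat" where
  "root_node Leaf = 0"
| "root_node (l \<or>\<^sub>t r) = size l + 1"

text \<open>Internal edges, as pairs (child, parent).\<close>

fun node_edges :: "ptree \<Rightarrow> (nat \<times> nat) set" where
  "node_edges Leaf = {}"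
| "node_edges (l \<or>\<^sub>t r) = (let k = size l + 1 in
     node_edges l \<union> {(k + i, k + j) | i j. (i, j) \<in> node_edges r}
     \<union> (if l = Leaf then {} else {(root_node l, k)})
     \<union> (if r = Leaf then {} else {(k + root_node r, k)}))"

definition node_le :: "ptree \<Rightarrow> nat \<Rightarrow> nat \<Rightarrow> bool"
  where "node_le t i j \<longleftrightarrow>
    i \<in> {1..size t} \<and> j \<in> {1..size t} \<and> (i, j) \<in> (node_edges t)\<^sup>*"

fun split_tree :: "ptree \<Rightarrow> nat \<Rightarrow> ptree \<times> ptree" where
  "split_tree Leaf i = (Leaf, Leaf)"
| "split_tree (a \<or>\<^sub>t c) i =
     (if i \<le> size a then (let (a0, a1) = split_tree a i in (a0, a1 \<or>\<^sub>t c))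
      else (let (c0, c1) = split_tree c (i - size a - 1) in (a \<or>\<^sub>t c0, c1)))"


section \<open>Bi-leveled trees\<close>

definition upper_ideal :: "ptree \<Rightarrow> nat set \<Rightarrow> bool"
  where "upper_ideal t T \<longleftrightarrow>
    T \<subseteq> {1..size t} \<and> (\<forall>i j. i \<in> T \<longrightarrow> node_le t i j \<longrightarrow> j \<in> T)"

text \<open>
  The conditions on node 1 do not apply to the tree without nodes, whose only ideal is empty.
\<close>

definition bileveled :: "ptree \<times> nat set \<Rightarrow> bool"
  where "bileveled = (\<lambda>(t, T). upper_ideal t T \<and>
    (t \<noteq> Leaf \<longrightarrow> 1 \<in> T \<and> (\<forall>i\<in>T. node_le t i 1 \<longrightarrow> i = 1)))"

typedef bitree = "{b. bileveled b}"
  by (rule exI[of _ "(Leaf, {})"]) (simp add: bileveled_def upper_ideal_def)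

setup_lifting type_definition_bitree

text \<open>
  Splitting a tree together with a set of nodes. The second part of a splitting of a bi-leveled
  tree need not be bi-leveled, so it stays a bare pair.
\<close>

definition split_marked ::
  "ptree \<times> nat set \<Rightarrow> nat \<Rightarrow> (ptree \<times> nat set) \<times> (ptree \<times> nat set)"
  where "split_marked = (\<lambda>(t, T) i.
    let (t0, t1) = split_tree t i in ((t0, T \<inter> {1..i}), (t1, {j. 1 \<le> j \<and> i + j \<in> T})))"

lemma size_split:
  "size (fst (split_tree t i)) = min i (size t)" "size (snd (split_tree t i)) = size t - i"
proof -
  have "size (fst (split_tree t i)) = min i (size t) \<and> size (snd (split_tree t i)) = size t - i"
  proof (induction t arbitrary: i)
    case (Node a c)
    show ?case
    proof (cases "i \<le> size a")
      case True
      then show ?thesis using Node.IH(1)[of i] by (simp add: case_prod_beta Let_def)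
    next
      case False
      then show ?thesis using Node.IH(2)[of "i - size a - 1"]
        by (auto simp: case_prod_beta Let_def min_def)
    qed
  qed simp
  then show "size (fst (split_tree t i)) = min i (size t)"
    and "size (snd (split_tree t i)) = size t - i"
    by blast+
qed

lemma shift_rtrancl:
  assumes "(i, j) \<in> (node_edges r)\<^sup>*"
  shows "(size l + 1 + i, size l + 1 + j) \<in> (node_edges (l \<or>\<^sub>t r))\<^sup>*"
  using assms
proof induction
  case (step y z)
  then have "(size l + 1 + y, size l + 1 + z) \<in> node_edges (l \<or>\<^sub>t r)"
    by (auto simp: Let_def)
  with step.IH show ?case by (rule rtrancl_into_rtrancl)
qed simp

lemma left_rtrancl: "(i, j) \<in> (node_edges l)\<^sup>* \<Longrightarrow> (i, j) \<in> (node_edges (l \<or>\<^sub>t r))\<^sup>*"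
  by (erule rtrancl_mono[THEN subsetD, rotated]) (auto simp: Let_def)

lemma le_root: "i \<in> {1..size t} \<Longrightarrow> (i, root_node t) \<in> (node_edges t)\<^sup>*"
proof (induction t arbitrary: i)
  case (Node l r)
  consider "i \<in> {1..size l}" | "i = size l + 1" | k where "k \<in> {1..size r}" "i = size l + 1 + k"
  proof (cases "i \<le> size l + 1")
    case False
    then show ?thesis by (intro that(3)[of "i - (size l + 1)"]) (use Node.prems in auto)
  qed (use Node.prems that in fastforce)
  then show ?case
  proof cases
    case 1
    then have "(root_node l, root_node (l \<or>\<^sub>t r)) \<in> node_edges (l \<or>\<^sub>t r)"
      by (auto simp: Let_def)
    with left_rtrancl[OF Node.IH(1)[OF 1]] show ?thesis by (rule rtrancl_into_rtrancl)
  next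
    case 3
    then have "(size l + 1 + root_node r, root_node (l \<or>\<^sub>t r)) \<in> node_edges (l \<or>\<^sub>t r)"
      by (auto simp: Let_def)
    with shift_rtrancl[OF Node.IH(2)[OF 3(1)]] 3(2) show ?thesis
      by (metis rtrancl_into_rtrancl)
  qed simp
qed simp

lemma node_edges_split: "node_edges (fst (split_tree t i)) \<subseteq> (node_edges t)\<^sup>*"
proof (induction t arbitrary: i)
  case (Node a c)
  show ?case
  proof (cases "i \<le> size a")
    case True
    then have "fst (split_tree (a \<or>\<^sub>t c) i) = fst (split_tree a i)"
      by (simp add: case_prod_beta Let_def)
    moreover have "(node_edges a)\<^sup>* \<subseteq> (node_edges (a \<or>\<^sub>t c))\<^sup>*"
      using left_rtrancl[of _ _ a c] by (intro subrelI)
    ultimately show ?thesis using Node.IH(1)[of i] by (metis subset_trans)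
  next
    case False
    let ?c0 = "fst (split_tree c (i - size a - 1))"
    have root: "(size a + 1 + root_node ?c0, size a + 1) \<in> (node_edges (a \<or>\<^sub>t c))\<^sup>*"
      if "?c0 \<noteq> Leaf"
    proof -
      have "root_node ?c0 \<in> {1..size ?c0}" using that by (cases ?c0) auto
      then have "root_node ?c0 \<in> {1..size c}" by (simp add: size_split)
      from shift_rtrancl[OF le_root[OF this]]
      have "(size a + 1 + root_node ?c0, size a + 1 + root_node c) \<in> (node_edges (a \<or>\<^sub>t c))\<^sup>*" .
      moreover have "(size a + 1 + root_node c, size a + 1) \<in> node_edges (a \<or>\<^sub>t c)"
        using that by (auto simp: Let_def)
      ultimately show ?thesis by (rule rtrancl_into_rtrancl)
    qed
    have c: "(size a + 1 + x, size a + 1 + y) \<in> (node_edges (a \<or>\<^sub>t c))\<^sup>*"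
      if "(x, y) \<in> node_edges ?c0" for x y
      by (rule shift_rtrancl[OF subsetD[OF Node.IH(2) that]])
    have "fst (split_tree (a \<or>\<^sub>t c) i) = a \<or>\<^sub>t ?c0"
      using False by (simp add: case_prod_beta Let_def)
    moreover have "node_edges (a \<or>\<^sub>t ?c0) \<subseteq> (node_edges (a \<or>\<^sub>t c))\<^sup>*"
    proof
      fix e assume "e \<in> node_edges (a \<or>\<^sub>t ?c0)"
      then consider "e \<in> node_edges a" | x y where "(x, y) \<in> node_edges ?c0"
          "e = (size a + 1 + x, size a + 1 + y)"
        | "a \<noteq> Leaf" "e = (root_node a, size a + 1)"
        | "?c0 \<noteq> Leaf" "e = (size a + 1 + root_node ?c0, size a + 1)"
        by (auto simp: Let_def split: if_splits)
      then show "e \<in> (node_edges (a \<or>\<^sub>t c))\<^sup>*"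
      proof cases
        case 1
        then have "e \<in> node_edges (a \<or>\<^sub>t c)" by (simp add: Let_def)
        then show ?thesis by (rule r_into_rtrancl)
      next
        case 2
        then show ?thesis using c by simp
      next
        case 3
        then have "e \<in> node_edges (a \<or>\<^sub>t c)" by (simp add: Let_def)
        then show ?thesis by (rule r_into_rtrancl)
      next
        case 4
        then show ?thesis using root by simp
      qed
    qed
    ultimately show ?thesis by simp
  qed
qed simp

lemma bileveled_split_marked:
  assumes "bileveled b"
  shows "bileveled (fst (split_marked b i))"
proof -
  obtain t T where b: "b = (t, T)" by (cases b)
  define t0 where "t0 = fst (split_tree t i)"
  have size: "size t0 = min i (size t)"
    unfolding t0_def by (rule size_split)
  have sub: "(node_edges t0)\<^sup>* \<subseteq> (node_edges t)\<^sup>*"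
    unfolding t0_def by (rule rtrancl_subset_rtrancl[OF node_edges_split])
  have le: "node_le t x y" if "node_le t0 x y" for x y
    using that subsetD[OF sub] unfolding node_le_def size by simp
  have T: "T \<subseteq> {1..size t}" and up: "\<And>x y. x \<in> T \<Longrightarrow> node_le t x y \<Longrightarrow> y \<in> T"
    and min: "t \<noteq> Leaf \<Longrightarrow> 1 \<in> T" "\<And>x. t \<noteq> Leaf \<Longrightarrow> x \<in> T \<Longrightarrow> node_le t x 1 \<Longrightarrow> x = 1"
    using assms unfolding b bileveled_def upper_ideal_def by blast+
  have "upper_ideal t0 (T \<inter> {1..i})"
    unfolding upper_ideal_def
  proof (intro conjI allI impI)
    show "T \<inter> {1..i} \<subseteq> {1..size t0}" using T unfolding size by auto
    fix x y assume "x \<in> T \<inter> {1..i}" and xy: "node_le t0 x y"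
    then have "y \<in> T" using up le by blast
    moreover have "y \<in> {1..i}" using xy unfolding node_le_def size by simp
    ultimately show "y \<in> T \<inter> {1..i}" by blast
  qed
  moreover have "1 \<in> T \<inter> {1..i} \<and> (\<forall>x\<in>T \<inter> {1..i}. node_le t0 x 1 \<longrightarrow> x = 1)"
    if "t0 \<noteq> Leaf"
  proof -
    have "size t0 \<noteq> 0" using that by (cases t0) simp_all
    then have i: "1 \<le> i" and "size t \<noteq> 0" unfolding size by simp_all
    then have "t \<noteq> Leaf" by (cases t) simp_all
    with i min le show ?thesis by simp
  qed
  ultimately have "bileveled (t0, T \<inter> {1..i})"
    unfolding bileveled_def by simp
  moreover have "fst (split_marked b i) = (t0, T \<inter> {1..i})"
    by (simp add: b split_marked_def case_prod_beta Let_def t0_def)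
  ultimately show ?thesis by (simp only:)
qed

lift_definition bitree_size :: "bitree \<Rightarrow> nat" is "\<lambda>b. size (fst b)" .

lift_definition left_part :: "bitree \<Rightarrow> nat \<Rightarrow> bitree" is "\<lambda>b i. fst (split_marked b i)"
  by (rule bileveled_split_marked)

lift_definition right_part :: "bitree \<Rightarrow> nat \<Rightarrow> ptree \<times> nat set"
  is "\<lambda>b i. snd (split_marked b i)" .

abbreviation underlying_tree :: "ptree \<times> nat set \<Rightarrow> ptree"  (\<open>\<phi>\<close>)
  where "\<phi> \<equiv> fst"


section \<open>The coalgebra YSym and the space MSym\<close>

type_synonym ysym = "ptree \<Rightarrow>\<^sub>0 rat"
type_synonym msym = "bitree \<Rightarrow>\<^sub>0 rat"

definition YSym_coproduct :: "ysym \<Rightarrow> (ptree \<times> ptree \<Rightarrow>\<^sub>0 rat)"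
  where "YSym_coproduct =
    lin_ext (\<lambda>t. \<Sum>i\<le>size t. let (t0, t1) = split_tree t i in F t0 \<otimes> F t1)"

definition YSym_counit :: "ysym \<Rightarrow> rat"
  where "YSym_counit x = Poly_Mapping.lookup x Leaf"

definition MSym_coaction :: "msym \<Rightarrow> (bitree \<times> ptree \<Rightarrow>\<^sub>0 rat)"
  where "MSym_coaction =
    lin_ext (\<lambda>b. \<Sum>i\<le>bitree_size b. F (left_part b i) \<otimes> F (\<phi> (right_part b i)))"

lemma MSym_coaction_F:
  "MSym_coaction (F b) =
    (\<Sum>i\<le>bitree_size b. F (left_part b i) \<otimes> F (\<phi> (right_part b i)))"
  by (simp add: MSym_coaction_def)

end

theory Submission
  imports Defs
begin

text \<open>
  A tree (or bi-leveled tree) of degree \<open>n\<close> can be split along any of its leaves \<open>0, \<dots>, n\<close>, and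
  both the coproduct of YSym and the coaction on MSym sum over these splittings. Both
  coassociativity identities therefore hold for the same reason: choosing two leaves \<open>j \<le> i\<close>
  cuts an object into three pieces, and the pieces do not depend on which of the two cuts comes
  first. Cutting at \<open>i\<close> and then the left part at \<open>j\<close> enumerates the pairs \<open>j \<le> i \<le> n\<close>; cutting
  at \<open>j\<close> and then the right part at \<open>i - j\<close> enumerates the same pairs, and the terms
  agree one by one. The counit keeps only the splitting with an empty right part, which
  is the one along the last leaf and returns the object itself.

  The locale \<open>leaf_splitting\<close> isolates what this argument uses. Its instance for plain trees rests
  on \<open>cut_twice\<close>, an induction on the tree. For bi-leveled trees the right part of the splitting is
  only seen through its underlying tree, so the marked nodes matter in the left part alone; there
  cutting restricts the set of marked nodes to \<open>{1..i}\<close>, and such restrictions compose.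
\<close>

section \<open>Linear maps on spaces with a basis\<close>

lemma flinear_sum: "flinear f \<Longrightarrow> f (sum g A) = (\<Sum>a\<in>A. f (g a))"
proof -
  assume "flinear f"
  then interpret f: Vector_Spaces.linear fscale fscale f .
  show ?thesis by (rule f.sum)
qed

lemma flinear_compose: "flinear f \<Longrightarrow> flinear g \<Longrightarrow> flinear (\<lambda>x. f (g x))"
  using Vector_Spaces.linear_compose[of fscale fscale g fscale f] by (simp add: o_def)

lemma flinear_eqI:
  assumes "flinear f" "flinear g" "\<And>a. f (F a) = g (F a)"
  shows "f x = g x"
proof -
  have "f = lin_ext (\<lambda>a. f (F a))" by (rule flinear_eq_lin_ext[OF assms(1)])
  also have "\<dots> = lin_ext (\<lambda>a. g (F a))" by (simp only: assms(3))
  also have "\<dots> = g" by (rule flinear_eq_lin_ext[OF assms(2), symmetric])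
  finally show ?thesis by (rule fun_cong)
qed

lemma flinear_id: "flinear (\<lambda>x. x)"
  by (intro Vector_Spaces.linear_iff[THEN iffD2] conjI allI vector_space_fscale) simp_all

lemma flinear_tensor_map: "flinear (tensor_map f g)"
  unfolding tensor_map_def by (rule flinear_lin_ext)

lemma flinear_tensor_assoc: "flinear tensor_assoc"
  unfolding tensor_assoc_def by (rule flinear_lin_ext)

lemma flinear_tensor_unit_left: "flinear (tensor_unit_left e)"
  unfolding tensor_unit_left_def by (rule flinear_lin_ext)

lemma flinear_tensor_unit_right: "flinear (tensor_unit_right e)"
  unfolding tensor_unit_right_def by (rule flinear_lin_ext)

lemma tensor_map_F: "tensor_map f g (F (a, b)) = f (F a) \<otimes> g (F b)"
  by (simp add: tensor_map_def)

lemma tensor_assoc_F: "tensor_assoc (F ((a, b), c)) = F (a, b, c)"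
  by (simp add: tensor_assoc_def)

lemma tensor_unit_left_F: "tensor_unit_left e (F (a, b)) = e (F a) *\<^sub>F F b"
  by (simp add: tensor_unit_left_def)

lemma tensor_unit_right_F: "tensor_unit_right e (F (a, b)) = e (F b) *\<^sub>F F a"
  by (simp add: tensor_unit_right_def)

lemma sum_fscale_indicator:
  assumes "finite A" "k \<in> A"
  shows "(\<Sum>i\<in>A. (if i = k then 1 else 0) *\<^sub>F f i) = f k"
  using assms
  by (auto intro!: poly_mapping_eqI simp: lookup_sum if_distrib[of "\<lambda>c. c * _"] cong: if_cong)


section \<open>Cutting a tree along two leaves\<close>

abbreviation left_split :: "ptree \<Rightarrow> nat \<Rightarrow> ptree"
  where "left_split t i \<equiv> fst (split_tree t i)"

abbreviation right_split :: "ptree \<Rightarrow> nat \<Rightarrow> ptree"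
  where "right_split t i \<equiv> snd (split_tree t i)"

lemma split_Node_left:
  "i \<le> size a \<Longrightarrow> split_tree (a \<or>\<^sub>t c) i = (left_split a i, right_split a i \<or>\<^sub>t c)"
  by (simp add: case_prod_beta Let_def)

lemma split_Node_right:
  "size a < i \<Longrightarrow> split_tree (a \<or>\<^sub>t c) i =
     (a \<or>\<^sub>t left_split c (i - size a - 1), right_split c (i - size a - 1))"
  by (simp add: case_prod_beta Let_def)

text \<open>
  The two cuts commute because each follows the path from its leaf to the root, and these paths
  separate the same nodes whether or not the other cut has been made. In the induction only the
  positions of \<open>j\<close> and \<open>i\<close> relative to the root matter; if the root lies between them, it belongs
  to the middle piece.
\<close>

lemma cut_twice:
  assumes "j \<le> i" "i \<le> size t"
  shows "left_split (left_split t i) j = left_split t j \<and>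
    right_split (left_split t i) j = left_split (right_split t j) (i - j) \<and>
    right_split (right_split t j) (i - j) = right_split t i"
  using assms
proof (induction t arbitrary: i j)
  case (Node a c)
  consider "i \<le> size a" | "j \<le> size a" "size a < i" | "size a < j" by linarith
  then show ?case
  proof cases
    case 1
    with Node.prems Node.IH(1)[of j i] show ?thesis
      by (simp add: split_Node_left size_split del: split_tree.simps)
  next
    case 2
    then have "i - j - (size a - j) - 1 = i - size a - 1" by simp
    with 2 Node.prems show ?thesis
      by (simp add: split_Node_left split_Node_right size_split del: split_tree.simps)
  next
    case 3
    then have "i - size a - 1 - (j - size a - 1) = i - j" using Node.prems by simp
    with 3 Node.prems Node.IH(2)[of "j - size a - 1" "i - size a - 1"] show ?thesis
      by (simp add: split_Node_right del: split_tree.simps)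
  qed
qed simp

lemmas left_left_split = cut_twice[THEN conjunct1]
  and right_left_split = cut_twice[THEN conjunct2, THEN conjunct1]
  and right_right_split = cut_twice[THEN conjunct2, THEN conjunct2]

lemma split_first_leaf: "split_tree t 0 = (Leaf, t)"
  by (induction t) simp_all

lemma split_last_leaf: "split_tree t (size t) = (t, Leaf)"
  by (induction t) simp_all

lemma size_eq_0_iff_Leaf: "size t = 0 \<longleftrightarrow> t = Leaf" for t :: ptree
  by (cases t) simp_all


section \<open>Sums over splittings\<close>

text \<open>
  Objects of type \<open>'m\<close> that can be split along a leaf into an object of the same kind and a
  tree. The last three assumptions say that two cuts give the same three pieces in either order.
\<close>

locale leaf_splitting =
  fixes deg :: "'m \<Rightarrow> nat"
    and left :: "'m \<Rightarrow> nat \<Rightarrow> 'm"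
    and right :: "'m \<Rightarrow> nat \<Rightarrow> ptree"
  assumes deg_left: "i \<le> deg b \<Longrightarrow> deg (left b i) = i"
    and size_right: "i \<le> deg b \<Longrightarrow> size (right b i) = deg b - i"
    and left_deg: "left b (deg b) = b"
    and left_left: "j \<le> i \<Longrightarrow> i \<le> deg b \<Longrightarrow> left (left b i) j = left b j"
    and right_left: "j \<le> i \<Longrightarrow> i \<le> deg b \<Longrightarrow>
      right (left b i) j = left_split (right b j) (i - j)"
    and right_right: "j \<le> i \<Longrightarrow> i \<le> deg b \<Longrightarrow>
      right_split (right b j) (i - j) = right b i"
begin

definition coaction :: "('m \<Rightarrow>\<^sub>0 'k::field) \<Rightarrow> ('m \<times> ptree \<Rightarrow>\<^sub>0 'k)"
  where "coaction = lin_ext (\<lambda>b. \<Sum>i\<le>deg b. F (left b i, right b i))"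

lemma flinear_coaction: "flinear coaction"
  unfolding coaction_def by (rule flinear_lin_ext)

lemma coaction_F: "coaction (F b) = (\<Sum>i\<le>deg b. F (left b i, right b i))"
  by (simp add: coaction_def)

text \<open>
  On a basis element both sides are sums over pairs of leaves \<open>j \<le> i\<close>. The left-hand side chooses
  \<open>i\<close> first, the right-hand side chooses \<open>j\<close> and the offset \<open>k = i - j\<close>.
\<close>

lemma coaction_coassoc:
  fixes D :: "(ptree \<Rightarrow>\<^sub>0 'k::field) \<Rightarrow> (ptree \<times> ptree \<Rightarrow>\<^sub>0 'k)"
  assumes D: "\<And>t. D (F t) = (\<Sum>k\<le>size t. F (left_split t k, right_split t k))"
  shows "tensor_assoc (tensor_map coaction id (coaction x)) = tensor_map id D (coaction x)"
proof (rule flinear_eqI[of _ _ x])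
  show "flinear (\<lambda>x. tensor_assoc (tensor_map coaction id (coaction x)))"
    and "flinear (\<lambda>x. tensor_map id D (coaction x))"
    by (intro flinear_compose[OF flinear_tensor_assoc] flinear_compose[OF flinear_tensor_map]
        flinear_coaction)+
next
  fix b
  let ?n = "deg b"
  let ?f = "\<lambda>i j. F (left (left b i) j, right (left b i) j, right b i) ::
    'm \<times> ptree \<times> ptree \<Rightarrow>\<^sub>0 'k"
  let ?g = "\<lambda>j k. F (left b j, left_split (right b j) k, right_split (right b j) k) ::
    'm \<times> ptree \<times> ptree \<Rightarrow>\<^sub>0 'k"
  have "tensor_assoc (tensor_map coaction id (coaction (F b))) = (\<Sum>i\<le>?n. \<Sum>j\<le>i. ?f i j)"
    by (simp add: coaction_F flinear_sum[OF flinear_tensor_map] tensor_map_F deg_left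
        flinear_sum[OF flinear_tensor_assoc] flinear_sum[OF flinear_tensor_left] tensor_assoc_F)
  also have "\<dots> = (\<Sum>(i, j)\<in>(SIGMA i:{..?n}. {..i}). ?f i j)"
    by (simp add: sum.Sigma)
  also have "\<dots> = (\<Sum>(j, k)\<in>(SIGMA j:{..?n}. {..?n - j}). ?g j k)"
    by (rule sum.reindex_bij_witness[of _ "\<lambda>(j, k). (j + k, j)" "\<lambda>(i, j). (j, i - j)"])
       (auto simp: left_left right_left right_right simp del: prod.collapse)
  also have "\<dots> = (\<Sum>j\<le>?n. \<Sum>k\<le>?n - j. ?g j k)"
    by (simp add: sum.Sigma)
  also have "\<dots> = tensor_map id D (coaction (F b))"
    by (simp add: coaction_F flinear_sum[OF flinear_tensor_map] tensor_map_F D size_right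
        flinear_sum[OF flinear_tensor_right])
  finally show "tensor_assoc (tensor_map coaction id (coaction (F b))) =
    tensor_map id D (coaction (F b))" .
qed

text \<open>
  The right part of a splitting along leaf \<open>i\<close> has \<open>deg b - i\<close> nodes, so it is the tree without
  nodes only for the last leaf.
\<close>

lemma coaction_counit:
  fixes e :: "(ptree \<Rightarrow>\<^sub>0 'k::field) \<Rightarrow> 'k"
  assumes e: "\<And>t. e (F t) = (if t = Leaf then 1 else 0)"
  shows "tensor_unit_right e (coaction x) = x"
proof (rule flinear_eqI[of _ _ x])
  show "flinear (\<lambda>x. tensor_unit_right e (coaction x))"
    by (rule flinear_compose[OF flinear_tensor_unit_right flinear_coaction])
  show "flinear (\<lambda>x :: 'm \<Rightarrow>\<^sub>0 'k. x)" by (rule flinear_id)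
next
  fix b
  have "right b i = Leaf \<longleftrightarrow> i = deg b" if "i \<le> deg b" for i
    using size_right[OF that] that size_eq_0_iff_Leaf[of "right b i"] by auto
  then have "tensor_unit_right e (coaction (F b)) =
      (\<Sum>i\<le>deg b. (if i = deg b then 1 else 0) *\<^sub>F F (left b i))"
    by (simp add: coaction_F flinear_sum[OF flinear_tensor_unit_right] tensor_unit_right_F e
        cong: sum.cong_simp)
  then show "tensor_unit_right e (coaction (F b)) = F b"
    by (simp only: sum_fscale_indicator[OF finite_atMost] atMost_iff order_refl left_deg)
qed

end


section \<open>The coalgebra YSym\<close>

interpretation tree: leaf_splitting size left_split right_split
  by unfold_locales
    (simp_all add: size_split split_last_leaf left_left_split right_left_split
      right_right_split)

lemma YSym_coproduct_eq: "YSym_coproduct = tree.coaction"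
  unfolding YSym_coproduct_def tree.coaction_def by (simp add: case_prod_beta Let_def)

lemma YSym_counit_F: "YSym_counit (F t) = (if t = Leaf then 1 else 0)"
  by (simp add: YSym_counit_def lookup_single)

text \<open>
  Mirror image of the counit law for the right factor: the left part of a splitting along leaf \<open>i\<close>
  has \<open>i\<close> nodes, so only leaf \<open>0\<close> contributes.
\<close>

lemma YSym_counit_left: "tensor_unit_left YSym_counit (YSym_coproduct x) = x"
proof (rule flinear_eqI[of _ _ x])
  show "flinear (\<lambda>x. tensor_unit_left YSym_counit (YSym_coproduct x))"
    unfolding YSym_coproduct_eq
    by (rule flinear_compose[OF flinear_tensor_unit_left tree.flinear_coaction])
  show "flinear (\<lambda>x :: ysym. x)" by (rule flinear_id)
next
  fix t
  have "left_split t i = Leaf \<longleftrightarrow> i = 0" if "i \<le> size t" for i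
    using tree.deg_left[OF that] size_eq_0_iff_Leaf[of "left_split t i"] by auto
  then have "tensor_unit_left YSym_counit (YSym_coproduct (F t)) =
      (\<Sum>i\<le>size t. (if i = 0 then 1 else 0) *\<^sub>F F (right_split t i))"
    by (simp add: YSym_coproduct_eq tree.coaction_F flinear_sum[OF flinear_tensor_unit_left]
        tensor_unit_left_F YSym_counit_F cong: sum.cong_simp del: prod.collapse)
  also have "\<dots> = F (right_split t 0)"
    by (rule sum_fscale_indicator) simp_all
  finally show "tensor_unit_left YSym_counit (YSym_coproduct (F t)) = F t"
    by (simp add: split_first_leaf)
qed

lemma coalgebra_YSym: "coalgebra YSym_coproduct YSym_counit"
proof (rule coalgebra.intro)
  show "flinear YSym_coproduct"
    unfolding YSym_coproduct_eq by (rule tree.flinear_coaction)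
  show "ffunctional YSym_counit"
    by (intro Vector_Spaces.linear_iff[THEN iffD2] conjI allI vector_space_fscale
        vector_space_mult) (simp_all add: YSym_counit_def lookup_add)
  fix x
  show "tensor_assoc (tensor_map YSym_coproduct id (YSym_coproduct x)) =
      tensor_map id YSym_coproduct (YSym_coproduct x)"
    unfolding YSym_coproduct_eq by (rule tree.coaction_coassoc) (rule tree.coaction_F)
  show "tensor_unit_left YSym_counit (YSym_coproduct x) = x"
    by (rule YSym_counit_left)
  show "tensor_unit_right YSym_counit (YSym_coproduct x) = x"
    unfolding YSym_coproduct_eq by (rule tree.coaction_counit) (rule YSym_counit_F)
qed


section \<open>The coaction on MSym\<close>

lemma split_marked_eq:
  "split_marked (t, T) i =
    ((left_split t i, T \<inter> {1..i}), (right_split t i, {j. 1 \<le> j \<and> i + j \<in> T}))"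
  by (simp add: split_marked_def case_prod_beta)

lemma bileveled_nodes: "bileveled (t, T) \<Longrightarrow> T \<subseteq> {1..size t}"
  by (simp add: bileveled_def upper_ideal_def)

interpretation bitree: leaf_splitting bitree_size left_part "\<lambda>b i. \<phi> (right_part b i)"
proof
  fix b i j
  show "i \<le> bitree_size b \<Longrightarrow> bitree_size (left_part b i) = i"
    by transfer (auto simp: split_marked_eq size_split)
  show "i \<le> bitree_size b \<Longrightarrow> size (\<phi> (right_part b i)) = bitree_size b - i"
    by transfer (auto simp: split_marked_eq size_split)
  show "left_part b (bitree_size b) = b"
    by transfer (use bileveled_nodes in \<open>fastforce simp: split_marked_eq split_last_leaf\<close>)
  show "j \<le> i \<Longrightarrow> i \<le> bitree_size b \<Longrightarrow> left_part (left_part b i) j = left_part b j"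
    by transfer (auto simp: split_marked_eq left_left_split)
  show "j \<le> i \<Longrightarrow> i \<le> bitree_size b \<Longrightarrow>
      \<phi> (right_part (left_part b i) j) = left_split (\<phi> (right_part b j)) (i - j)"
    by transfer (auto simp: split_marked_eq right_left_split)
  show "j \<le> i \<Longrightarrow> i \<le> bitree_size b \<Longrightarrow>
      right_split (\<phi> (right_part b j)) (i - j) = \<phi> (right_part b i)"
    by transfer (auto simp: split_marked_eq right_right_split)
qed

lemma MSym_coaction_eq: "MSym_coaction = bitree.coaction"
  unfolding MSym_coaction_def bitree.coaction_def by simp

theorem theorem3p4:
  shows "right_comodule YSym_coproduct YSym_counit MSym_coaction"
proof (intro right_comodule.intro coalgebra_YSym right_comodule_axioms.intro)
  show "flinear MSym_coaction"
    unfolding MSym_coaction_eq by (rule bitree.flinear_coaction)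
  fix x
  show "tensor_assoc (tensor_map MSym_coaction id (MSym_coaction x)) =
      tensor_map id YSym_coproduct (MSym_coaction x)"
    unfolding MSym_coaction_eq YSym_coproduct_eq
    by (rule bitree.coaction_coassoc) (rule tree.coaction_F)
  show "tensor_unit_right YSym_counit (MSym_coaction x) = x"
    unfolding MSym_coaction_eq by (rule bitree.coaction_counit) (rule YSym_counit_F)
qed

end
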